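(* Let $n\ge 3$ and fix any $\varepsilon_0>0$. Then there exist constants $\lambda,\Lambda$ with $0<\lambda\le\Lambda$ and a sequence of positive functions $u_k\in C^2(B_2)$, $k\in\mathbb{N}$, such that $$\big|P^-_{\lambda,\Lambda}(D^2u_k(x))\big|\le |Du_k(x)|^{1+\varepsilon_0}\qquad\text{for every } x\in B_2,$$ while $m_k=\inf_{B_1}u_k\to 0$ as $k\to\infty$ and $M_k=\sup_{B_1}u_k\ge 1$ for all $k\in\mathbb{N}$. In particular, $$\int_{m_k}^{M_k}\frac{ds}{s^{1+\varepsilon_0}+s}\to\infty\qquad\text{as } k\to\infty.$$
   Context: $B_r\subset\mathbb{R}^n$ is the open Euclidean ball of radius $r$ centered at the origin; $Du$ and $D^2u$ are the gradient and the Hessian matrix of $u$. For a real symmetric $n\times n$ matrix $M$ with eigenvalues $e_1,\dots,e_n$ (counted with multiplicity) and constants $0<\lambda\le\Lambda$, the Pucci extremal operator is $P^-_{\lambda,\Lambda}(M)=\lambda\sum_{e_i>0}e_i+\Lambda\sum_{e_i<0}e_i$. *)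

theory Defs
  imports "HOL-Analysis.Analysis"
begin

definition grad :: "(real ^ 'n \<Rightarrow> real) \<Rightarrow> real ^ 'n \<Rightarrow> real ^ 'n" where
  "grad u x = (\<chi> i. frechet_derivative u (at x) (axis i 1))"

definition hessian :: "(real ^ 'n \<Rightarrow> real) \<Rightarrow> real ^ 'n \<Rightarrow> real ^ 'n ^ 'n" where
  "hessian u x = jacobian (grad u) (at x)"

text \<open>
  The following is meant for open \<open>S\<close>. Continuity of \<open>u\<close> and of \<open>grad u\<close> on \<open>S\<close> is implied by
  their differentiability. Values of \<open>u\<close> outside \<open>S\<close> play no role.
\<close>

definition C2_on :: "(real ^ 'n) set \<Rightarrow> (real ^ 'n \<Rightarrow> real) \<Rightarrow> bool" where
  "C2_on S u \<longleftrightarrow>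
     (\<forall>x\<in>S. u differentiable (at x)) \<and>
     (\<forall>x\<in>S. grad u differentiable (at x)) \<and>
     continuous_on S (hessian u)"

definition eigenspace :: "real ^ 'n ^ 'n \<Rightarrow> real \<Rightarrow> (real ^ 'n) set" where
  "eigenspace M e = {v. M *v v = e *\<^sub>R v}"

definition eigenvalues :: "real ^ 'n ^ 'n \<Rightarrow> real set" where
  "eigenvalues M = {e. \<exists>v. v \<noteq> 0 \<and> v \<in> eigenspace M e}"

text \<open>
  The multiplicity of an eigenvalue is taken to be the dimension of its eigenspace; for the real
  symmetric matrices to which the Pucci operator is applied, this agrees with the multiplicity as a
  root of the characteristic polynomial.
\<close>

definition pucci_minus :: "real \<Rightarrow> real \<Rightarrow> real ^ 'n ^ 'n \<Rightarrow> real" where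
  "pucci_minus l L M =
     l * (\<Sum>e\<in>{e \<in> eigenvalues M. e > 0}. real (dim (eigenspace M e)) * e) +
     L * (\<Sum>e\<in>{e \<in> eigenvalues M. e < 0}. real (dim (eigenspace M e)) * e)"

text \<open>The sums in \<^const>\<open>pucci_minus\<close> are finite for symmetric matrices.\<close>

lemma finite_eigenvalues:
  fixes M :: "real ^ 'n ^ 'n"
  assumes "transpose M = M"
  shows "finite (eigenvalues M)"
proof -
  have "\<forall>e\<in>eigenvalues M. \<exists>v. v \<noteq> 0 \<and> M *v v = e *\<^sub>R v"
    by (auto simp: eigenvalues_def eigenspace_def)
  then obtain f where "\<forall>e\<in>eigenvalues M. f e \<noteq> 0 \<and> M *v f e = e *\<^sub>R f e"
    by (rule bchoice[THEN exE])
  then have f: "f e \<noteq> 0 \<and> M *v f e = e *\<^sub>R f e" if "e \<in> eigenvalues M" for e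
    using that by blast
  have orth: "f a \<bullet> f b = 0"
    if "a \<in> eigenvalues M" "b \<in> eigenvalues M" "a \<noteq> b" for a b
  proof -
    have "a * (f a \<bullet> f b) = (M *v f a) \<bullet> f b"
      using f[OF that(1)] by simp
    also have "\<dots> = f a \<bullet> (M *v f b)"
      using assms by (metis dot_lmul_matrix transpose_matrix_vector)
    also have "\<dots> = b * (f a \<bullet> f b)"
      using f[OF that(2)] by simp
    finally show ?thesis using that(3) by simp
  qed
  have "inj_on f (eigenvalues M)"
    by (rule inj_onI) (metis f inner_eq_zero_iff orth)
  moreover have "independent (f ` eigenvalues M)"
    by (rule pairwise_orthogonal_independent)
       (use f orth in \<open>auto simp: pairwise_def orthogonal_def\<close>)
  then have "finite (f ` eigenvalues M)"
    by (rule independent_imp_finite)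
  ultimately show ?thesis by (simp add: finite_image_iff)
qed

end

theory Submission
  imports Defs
begin

text \<open>
  Write \<open>z\<close> for the coordinate of \<open>x\<close> along a fixed axis \<open>e\<close> and \<open>t\<close> for the squared distance of
  \<open>x\<close> from that axis. With \<open>\<lambda> = n - 2\<close> and \<open>\<Lambda> = 2p + 1\<close>, the function \<open>d t\<^sup>-\<^sup>p\<close> solves
  \<open>P\<^sup>-(D\<^sup>2u) = 0\<close> away from the axis, and it is of order \<open>d\<close> at unit distance. Inside the thin tube
  \<open>t \<le> d\<close> it is continued by a radially decreasing polynomial in \<open>t\<close> of size \<open>K = d\<^sup>1\<^sup>-\<^sup>p\<close>, plus a tilt
  \<open>K/12 z (1 - t/d)\<^sup>3\<close> which keeps the gradient away from zero on the axis. There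
  \<open>|D\<^sup>2u| \<le> c K/d\<close> and \<open>|Du| \<ge> K/32\<close>, so the gradient power wins as soon as \<open>K\<close> raised to \<open>\<epsilon>\<^sub>0\<close>
  is much larger than \<open>1/d\<close>, that is, for large \<open>p\<close> and small \<open>d\<close>. Now let \<open>d \<rightarrow> 0\<close>.
\<close>

subsection \<open>The Pucci operator on matrices\<close>

lemma grad_eqI:
  assumes "(u has_derivative (\<lambda>h. G \<bullet> h)) (at x)"
  shows "grad u x = G"
  using frechet_derivative_at[OF assms, symmetric]
  by (simp add: grad_def vec_eq_iff inner_axis)

lemma hessian_eqI:
  assumes "(grad u has_derivative H) (at x)"
  shows "hessian u x = (\<chi> i j. H (axis j 1) $ i)"
  using frechet_derivative_at[OF assms, symmetric]
  by (simp add: hessian_def jacobian_def matrix_def)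

lemma hessian_mult:
  assumes "(grad u has_derivative H) (at x)"
  shows "hessian u x *v h = H h"
  using frechet_derivative_at[OF assms, symmetric] fun_cong[OF matrix_vector_mul(2)[OF has_derivative_linear[OF assms]], of h]
  by (simp add: hessian_def jacobian_def)

text \<open>Eigenvectors to distinct eigenvalues of a self-adjoint map are orthogonal, hence
  independent; picking one per eigenvalue maps the spectrum injectively onto an independent
  set.\<close>

lemma card_eigenvalues_le:
  fixes M :: "real ^ 'n ^ 'n"
  assumes sym: "\<And>v w. (M *v v) \<bullet> w = v \<bullet> (M *v w)"
  shows "finite (eigenvalues M) \<and> card (eigenvalues M) \<le> CARD('n)"
proof -
  have "\<forall>e\<in>eigenvalues M. \<exists>v. v \<noteq> 0 \<and> M *v v = e *\<^sub>R v"
    by (auto simp: eigenvalues_def eigenspace_def)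
  then obtain f where f: "\<And>e. e \<in> eigenvalues M \<Longrightarrow> f e \<noteq> 0"
      "\<And>e. e \<in> eigenvalues M \<Longrightarrow> M *v f e = e *\<^sub>R f e"
    by metis
  have orth: "f a \<bullet> f b = 0" if "a \<in> eigenvalues M" "b \<in> eigenvalues M" "a \<noteq> b" for a b
  proof -
    have "a * (f a \<bullet> f b) = b * (f a \<bullet> f b)"
      using sym[of "f a" "f b"] f that by simp
    then show ?thesis using that(3) by simp
  qed
  have inj: "inj_on f (eigenvalues M)"
    by (rule inj_onI) (metis f(1) inner_eq_zero_iff orth)
  have "independent (f ` eigenvalues M)"
    by (rule pairwise_orthogonal_independent)
       (use f orth in \<open>auto simp: pairwise_def orthogonal_def\<close>)
  then have "finite (f ` eigenvalues M) \<and> card (f ` eigenvalues M) \<le> CARD('n)"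
    using independent_bound by fastforce
  then show ?thesis
    using inj by (simp add: finite_image_iff card_image)
qed

text \<open>Every eigenvalue has modulus at most \<open>C\<close>, and there are at most n of them,
  each of multiplicity at most n. The factor n^2 is crude, but all that matters later is that it
  does not depend on the width of the tube.\<close>

lemma abs_pucci_minus_le:
  fixes M :: "real ^ 'n ^ 'n"
  assumes sym: "\<And>v w. (M *v v) \<bullet> w = v \<bullet> (M *v w)"
    and bound: "\<And>v. norm (M *v v) \<le> C * norm v"
    and lL: "0 \<le> l" "l \<le> L"
  shows "\<bar>pucci_minus l L M\<bar> \<le> L * (real CARD('n))\<^sup>2 * C"
proof -
  let ?E = "eigenvalues M" and ?w = "\<lambda>e. real (dim (eigenspace M e)) * e"
  note fin = card_eigenvalues_le[OF sym]
  let ?P = "{e \<in> ?E. e > 0}" and ?N = "{e \<in> ?E. e < 0}"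
  have le: "\<bar>e\<bar> \<le> C" if e: "e \<in> ?E" for e
  proof -
    obtain v where v: "v \<noteq> 0" "M *v v = e *\<^sub>R v"
      using e by (auto simp: eigenvalues_def eigenspace_def)
    then show ?thesis using bound[of v] by simp
  qed
  \<comment> \<open>No eigenvalue is known to exist at this point, so the sign of \<open>C\<close>
    is read off from a unit vector.\<close>
  have C: "0 \<le> C"
    using order_trans[OF norm_ge_zero bound[of "axis undefined 1"]] by (simp add: norm_axis_1)
  have w: "\<bar>?w e\<bar> \<le> real CARD('n) * C" if "e \<in> ?E" for e
  proof -
    have "dim (eigenspace M e) \<le> CARD('n)"
      using dim_subset_UNIV[of "eigenspace M e"] by simp
    then show ?thesis
      unfolding abs_mult using le[OF that] by (intro mult_mono) auto
  qed
  have "\<bar>pucci_minus l L M\<bar> \<le> l * \<bar>sum ?w ?P\<bar> + L * \<bar>sum ?w ?N\<bar>"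
    unfolding pucci_minus_def using lL by (intro order_trans[OF abs_triangle_ineq]) (simp add: abs_mult)
  also have "\<dots> \<le> L * (\<Sum>e\<in>?P. \<bar>?w e\<bar>) + L * (\<Sum>e\<in>?N. \<bar>?w e\<bar>)"
    using lL by (intro add_mono mult_mono sum_abs) auto
  also have "\<dots> = L * (\<Sum>e\<in>?P \<union> ?N. \<bar>?w e\<bar>)"
    using fin by (subst sum.union_disjoint) (auto simp: distrib_left)
  also have "\<dots> \<le> L * (\<Sum>e\<in>?E. \<bar>?w e\<bar>)"
    using fin lL by (intro mult_left_mono sum_mono2) auto
  also have "\<dots> \<le> L * (real (card ?E) * (real CARD('n) * C))"
    using w lL by (intro mult_left_mono sum_bounded_above) auto
  also have "\<dots> \<le> L * (real CARD('n) * (real CARD('n) * C))"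
    using fin lL C by (intro mult_left_mono mult_right_mono) auto
  finally show ?thesis by (simp add: power2_eq_square mult.assoc)
qed

text \<open>This is the shape of the Hessian of a function of the distance from the axis:
  \<open>M\<close> kills \<open>e\<close>, multiplies \<open>y\<close> by
  \<open>b + c * (y \<bullet> y)\<close>, and acts as \<open>b\<close> on the orthogonal complement
  of both, which has dimension n - 2.\<close>

lemma pucci_minus_two_eigenspaces:
  fixes M :: "real ^ 'n ^ 'n" and e y :: "real ^ 'n"
  assumes M: "\<And>h. M *v h = b *\<^sub>R (h - (h \<bullet> e) *\<^sub>R e) + (c * (y \<bullet> h)) *\<^sub>R y"
    and e: "norm e = 1" and y: "y \<noteq> 0" "y \<bullet> e = 0"
    and b: "b < 0" and a: "b + c * (y \<bullet> y) > 0"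
  shows "pucci_minus l L M = l * (b + c * (y \<bullet> y)) + L * (real (CARD('n) - 2) * b)"
proof -
  define a where "a = b + c * (y \<bullet> y)"
  have ee: "e \<bullet> e = 1" using e by (simp add: dot_square_norm)
  have Me: "(M *v h) \<bullet> e = 0" for h
    by (simp add: M inner_add_left inner_diff_left ee y)
  have My: "(M *v h) \<bullet> y = a * (h \<bullet> y)" for h
    using y(2) by (simp add: M a_def inner_add_left inner_diff_left inner_commute algebra_simps)
  have pos: "eigenspace M a = span {y}"
  proof
    show "eigenspace M a \<subseteq> span {y}"
    proof
      fix h assume h: "h \<in> eigenspace M a"
      then have Mh: "M *v h = a *\<^sub>R h" by (simp add: eigenspace_def)
      have "h \<bullet> e = 0" using Me[of h] assms(6) by (simp add: Mh a_def)
      then have "b *\<^sub>R h + (c * (y \<bullet> h)) *\<^sub>R y = a *\<^sub>R h"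
        using Mh by (simp add: M)
      then have "(a - b) *\<^sub>R h = (c * (y \<bullet> h)) *\<^sub>R y"
        by (simp add: algebra_simps)
      moreover have "a - b \<noteq> 0" using b assms(6) unfolding a_def by linarith
      ultimately have "h = ((c * (y \<bullet> h)) / (a - b)) *\<^sub>R y"
        by (simp add: vector_fraction_eq_iff eq_vector_fraction_iff)
      then show "h \<in> span {y}"
        unfolding span_singleton by blast
    qed
    show "span {y} \<subseteq> eigenspace M a"
      using y(2) by (auto simp: span_singleton eigenspace_def M a_def inner_commute algebra_simps)
  qed
  have neg: "eigenspace M b = {h. \<forall>v\<in>span {e, y}. orthogonal v h}"
  proof -
    have "h \<in> eigenspace M b \<longleftrightarrow> e \<bullet> h = 0 \<and> y \<bullet> h = 0" for h
    proof
      assume "h \<in> eigenspace M b"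
      then have Mh: "M *v h = b *\<^sub>R h" by (simp add: eigenspace_def)
      have "h \<bullet> e = 0" using Me[of h] b by (simp add: Mh)
      moreover have "h \<bullet> y = 0" using My[of h] b assms(6) by (auto simp: Mh a_def)
      ultimately show "e \<bullet> h = 0 \<and> y \<bullet> h = 0" by (simp add: inner_commute)
    next
      assume "e \<bullet> h = 0 \<and> y \<bullet> h = 0"
      then show "h \<in> eigenspace M b" by (simp add: eigenspace_def M inner_commute)
    qed
    moreover have "(\<forall>v\<in>span {e, y}. orthogonal v h) \<longleftrightarrow> e \<bullet> h = 0 \<and> y \<bullet> h = 0" for h
    proof
      assume "\<forall>v\<in>span {e, y}. orthogonal v h"
      then show "e \<bullet> h = 0 \<and> y \<bullet> h = 0"
        by (auto simp: orthogonal_def span_base)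
    next
      assume "e \<bullet> h = 0 \<and> y \<bullet> h = 0"
      then show "\<forall>v\<in>span {e, y}. orthogonal v h"
        using orthogonal_to_span[of _ "{e, y}" h] by (auto simp: orthogonal_def inner_commute[of h])
    qed
    ultimately show ?thesis by auto
  qed
  have ind: "independent {e, y}"
    by (rule pairwise_orthogonal_independent)
       (use e y inner_commute[of e y] in \<open>auto simp: pairwise_def orthogonal_def\<close>)
  have "e \<noteq> y" using y ee by auto
  then have dim2: "dim {e, y} = 2"
    using ind by (simp add: dim_eq_card_independent)
  have dimneg: "dim (eigenspace M b) = CARD('n) - 2"
    using dim_subspace_orthogonal_to_vectors[of "span {e, y}" UNIV] dim2 by (simp add: neg)
  have dimpos: "dim (eigenspace M a) = 1"
    using y by (simp add: pos)
  \<comment> \<open>\<open>Me\<close> and \<open>My\<close> test the eigenvalue equation against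
    \<open>e\<close> and \<open>y\<close>: if \<open>d\<close> is neither \<open>0\<close> nor
    \<open>a\<close>, the eigenvector is orthogonal to both, and there \<open>M\<close> acts as
    \<open>b\<close>.\<close>
  have only: "d = a \<or> d = b \<or> d = 0" if d: "d \<in> eigenvalues M" for d
  proof (rule ccontr)
    assume n: "\<not> (d = a \<or> d = b \<or> d = 0)"
    obtain h where h: "h \<noteq> 0" "M *v h = d *\<^sub>R h"
      using d by (auto simp: eigenvalues_def eigenspace_def)
    have "h \<bullet> e = 0" using Me[of h] n h by auto
    moreover have "h \<bullet> y = 0" using My[of h] n h by auto
    ultimately have "b *\<^sub>R h = d *\<^sub>R h" using h(2) by (simp add: M inner_commute)
    then show False using n h(1) by simp
  qed
  have apos: "a > 0" using assms(6) by (simp add: a_def)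
  have "a \<in> eigenvalues M"
    using y pos span_base[of y "{y}"] by (auto simp: eigenvalues_def)
  then have P: "{d \<in> eigenvalues M. d > 0} = {a}"
    using only b apos by fastforce
  have "{d \<in> eigenvalues M. d < 0} \<subseteq> {b}"
    using only apos by fastforce
  \<comment> \<open>For n = 2 the complement is trivial and \<open>b\<close> is no eigenvalue; its
    term is then zero, so the sum may be taken over \<open>{b}\<close> in every case.\<close>
  moreover have "dim (eigenspace M b) = 0" if "b \<notin> eigenvalues M"
  proof -
    have "eigenspace M b \<subseteq> {0}" using that by (auto simp: eigenvalues_def)
    then show ?thesis by simp
  qed
  ultimately have "(\<Sum>d\<in>{d \<in> eigenvalues M. d < 0}. real (dim (eigenspace M d)) * d)
      = (\<Sum>d\<in>{b}. real (dim (eigenspace M d)) * d)"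
    using b by (intro sum.mono_neutral_left) auto
  then have N: "(\<Sum>d\<in>{d \<in> eigenvalues M. d < 0}. real (dim (eigenspace M d)) * d)
      = real (CARD('n) - 2) * b"
    by (simp only: dimneg sum.insert finite.emptyI empty_iff sum.empty add_0_right not_False_eq_True)
  show ?thesis
    unfolding pucci_minus_def P N by (simp add: dimpos a_def[symmetric])
qed

subsection \<open>A twice continuously differentiable truncation of a negative power\<close>

text \<open>Pieces that agree at the seam in value and derivative glue differentiably. Each piece is
  differentiated on its own side only, so a power singular at 0 may serve as the right one.\<close>

lemma has_real_derivative_If:
  fixes f g :: "real \<Rightarrow> real"
  assumes f: "\<And>t. t \<le> a \<Longrightarrow> (f has_real_derivative f' t) (at t)"
    and g: "\<And>t. a \<le> t \<Longrightarrow> (g has_real_derivative g' t) (at t)"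
    and eq: "f a = g a" "f' a = g' a"
  shows "((\<lambda>t. if t \<le> a then f t else g t) has_real_derivative (if t \<le> a then f' t else g' t)) (at t)"
proof -
  have "((\<lambda>t. if t \<in> {..a} then f t else g t) has_vector_derivative
      (if t \<in> {..a} then f' t else g' t)) (at t within UNIV)"
  proof (rule has_vector_derivative_If_within_closures[where T="{a..}"])
    show "t \<in> {..a} \<union> (closure {..a} \<inter> closure {a..}) \<Longrightarrow>
        (f has_vector_derivative f' t) (at t within {..a} \<union> (closure {..a} \<inter> closure {a..}))"
      using f by (auto simp: has_real_derivative_iff_has_vector_derivative
        intro: has_vector_derivative_at_within)
    show "t \<in> {a..} \<union> (closure {..a} \<inter> closure {a..}) \<Longrightarrow>
        (g has_vector_derivative g' t) (at t within {a..} \<union> (closure {..a} \<inter> closure {a..}))"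
      using g by (auto simp: has_real_derivative_iff_has_vector_derivative
        intro: has_vector_derivative_at_within)
    have "t = a" if "t \<in> closure {..a}" "t \<in> closure {a..}"
      using that by simp
    then show "t \<in> closure {..a} \<Longrightarrow> t \<in> closure {a..} \<Longrightarrow> f t = g t"
      "t \<in> closure {..a} \<Longrightarrow> t \<in> closure {a..} \<Longrightarrow> f' t = g' t"
      using eq by blast+
  qed auto
  then show ?thesis
    by (simp add: has_real_derivative_iff_has_vector_derivative)
qed

text \<open>\<open>cap p\<close> continues \<open>t\<^sup>-\<^sup>p\<close> below \<open>t = 1\<close> by its second Taylor polynomial at \<open>1\<close>, so that it is \<open>C\<^sup>2\<close>.\<close>

definition cap :: "nat \<Rightarrow> real \<Rightarrow> real" where
  "cap p t = (if t \<le> 1 then 1 - real p * (t - 1) + real p * (real p + 1) / 2 * (t - 1)\<^sup>2 else 1 / t ^ p)"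

definition cap' :: "nat \<Rightarrow> real \<Rightarrow> real" where
  "cap' p t = (if t \<le> 1 then - real p + real p * (real p + 1) * (t - 1) else - real p / t ^ (p + 1))"

definition cap'' :: "nat \<Rightarrow> real \<Rightarrow> real" where
  "cap'' p t = (if t \<le> 1 then real p * (real p + 1) else real p * (real p + 1) / t ^ (p + 2))"

text \<open>Three is the least integer exponent for which the truncation at 1 is twice continuously
  differentiable.\<close>

definition bump :: "real \<Rightarrow> real" where
  "bump t = (if t \<le> 1 then (1 - t) ^ 3 else 0)"

definition bump' :: "real \<Rightarrow> real" where
  "bump' t = (if t \<le> 1 then - 3 * (1 - t)\<^sup>2 else 0)"

definition bump'' :: "real \<Rightarrow> real" where
  "bump'' t = (if t \<le> 1 then 6 * (1 - t) else 0)"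

section \<open>Derivatives and continuity of the profiles\<close>

lemma DERIV_one_over_power:
  assumes "(t::real) \<ge> 1"
  shows "((\<lambda>t. c / t ^ p) has_real_derivative - (c * p) / t ^ (p + 1)) (at t)"
proof -
  have "((\<lambda>t. c / t ^ p) has_real_derivative - c * (p * t ^ (p - 1)) / (t ^ p)\<^sup>2) (at t)"
    using assms by (auto intro!: derivative_eq_intros simp: power2_eq_square)
  also have "- c * (p * t ^ (p - 1)) / (t ^ p)\<^sup>2 = - (c * p) / t ^ (p + 1)"
    using assms by (cases p) (auto simp: field_simps power2_eq_square)
  finally show ?thesis .
qed

lemma DERIV_cap: "(cap p has_real_derivative cap' p t) (at t)"
  unfolding cap_def[abs_def] cap'_def[abs_def]
proof (rule has_real_derivative_If)
  fix t :: real assume "1 \<le> t"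
  then show "((\<lambda>t. 1 / t ^ p) has_real_derivative - real p / t ^ (p + 1)) (at t)"
    using DERIV_one_over_power[of t 1 p] by simp
qed (auto intro!: derivative_eq_intros)

lemma DERIV_cap': "(cap' p has_real_derivative cap'' p t) (at t)"
  unfolding cap'_def[abs_def] cap''_def[abs_def]
proof (rule has_real_derivative_If)
  fix t :: real assume "1 \<le> t"
  then show "((\<lambda>t. - real p / t ^ (p + 1)) has_real_derivative real p * (real p + 1) / t ^ (p + 2)) (at t)"
    using DERIV_one_over_power[of t "- real p" "p + 1"] by (simp add: algebra_simps)
qed (auto intro!: derivative_eq_intros)

lemma DERIV_bump: "(bump has_real_derivative bump' t) (at t)"
  unfolding bump_def[abs_def] bump'_def[abs_def]
  by (rule has_real_derivative_If) (auto intro!: derivative_eq_intros)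

lemma DERIV_bump': "(bump' has_real_derivative bump'' t) (at t)"
  unfolding bump'_def[abs_def] bump''_def[abs_def]
  by (rule has_real_derivative_If) (auto intro!: derivative_eq_intros)

lemma continuous_cap'': "continuous_on UNIV (cap'' p)"
  unfolding cap''_def[abs_def]
  by (intro continuous_on_cases_le[where h="\<lambda>t. t", simplified] continuous_intros) auto

lemma continuous_bump'': "continuous_on UNIV bump''"
  unfolding bump''_def[abs_def]
  by (intro continuous_on_cases_le[where h="\<lambda>t. t", simplified] continuous_intros) auto

subsection \<open>Functions of the axial coordinate and the distance from the axis\<close>

definition proj :: "'a::real_inner \<Rightarrow> 'a \<Rightarrow> 'a" where
  "proj e x = x - (x \<bullet> e) *\<^sub>R e"

text \<open>The square is a polynomial in \<open>x\<close>, so smooth functions of it stay smooth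
  across the axis.\<close>

definition sqdist :: "'a::real_inner \<Rightarrow> 'a \<Rightarrow> real" where
  "sqdist e x = x \<bullet> x - (x \<bullet> e)\<^sup>2"

lemma sqdist_eq: "norm e = 1 \<Longrightarrow> sqdist e x = proj e x \<bullet> proj e x"
  by (simp add: sqdist_def proj_def inner_diff_left inner_diff_right norm_eq_1
      inner_commute power2_eq_square)

lemma sqdist_nonneg: "norm e = 1 \<Longrightarrow> 0 \<le> sqdist e x"
  by (simp add: sqdist_eq)

lemma proj_inner_axis: "norm e = 1 \<Longrightarrow> proj e x \<bullet> e = 0"
  by (simp add: proj_def inner_diff_left dot_square_norm)

lemma has_derivative_sqdist:
  "(sqdist e has_derivative (\<lambda>h. 2 * (proj e x \<bullet> h))) (at x)"
  unfolding sqdist_def[abs_def] proj_def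
  by (auto intro!: derivative_eq_intros ext simp: inner_diff_left inner_commute algebra_simps)

lemma has_derivative_compose_sqdist:
  assumes "(A has_real_derivative A') (at (sqdist e x))"
  shows "((\<lambda>x. A (sqdist e x)) has_derivative (\<lambda>h. 2 * A' * (proj e x \<bullet> h))) (at x)"
  using has_derivative_compose[OF has_derivative_sqdist[of e x]
      assms[unfolded has_field_derivative_def]]
  by (simp add: mult_ac)

lemma has_derivative_proj: "(proj e has_derivative proj e) (at x)"
  unfolding proj_def[abs_def] by (auto intro!: derivative_eq_intros)

lemma inner_proj_commute: "proj e v \<bullet> w = v \<bullet> proj e w"
  by (simp add: proj_def inner_diff_left inner_diff_right inner_commute)

lemma norm_proj_le:
  assumes "norm e = 1" shows "norm (proj e x) \<le> norm x"
proof -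
  have "(norm (proj e x))\<^sup>2 \<le> (norm x)\<^sup>2"
    using sqdist_eq[OF assms, of x] zero_le_power2[of "x \<bullet> e"]
    unfolding sqdist_def dot_square_norm by linarith
  then show ?thesis by (rule power2_le_imp_le) simp
qed

text \<open>The profiles are differentiable on the whole line, so that the chain rule also applies
  on the axis, where the squared distance sits at the end of its range.\<close>

locale axial =
  fixes e :: "real ^ 'n" and A A' A'' B B' B'' :: "real \<Rightarrow> real"
  assumes e: "norm e = 1"
    and A: "\<And>t. (A has_real_derivative A' t) (at t)" "\<And>t. (A' has_real_derivative A'' t) (at t)"
      "continuous_on UNIV A''"
    and B: "\<And>t. (B has_real_derivative B' t) (at t)" "\<And>t. (B' has_real_derivative B'' t) (at t)"
      "continuous_on UNIV B''"
begin

definition fn :: "real ^ 'n \<Rightarrow> real" where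
  "fn x = A (sqdist e x) + (x \<bullet> e) * B (sqdist e x)"

text \<open>The derivative of the gradient \<open>2 (A' + z B') y + B e\<close> in direction
  \<open>h\<close>, where \<open>y\<close> changes by \<open>proj e h\<close>, \<open>t\<close> by
  \<open>2 (y \<bullet> h)\<close> and \<open>z\<close> by \<open>h \<bullet> e\<close>.\<close>

definition hess :: "real ^ 'n \<Rightarrow> real ^ 'n \<Rightarrow> real ^ 'n" where
  "hess x h = (let t = sqdist e x; z = x \<bullet> e; y = proj e x in
     (2 * (A' t + z * B' t)) *\<^sub>R proj e h
     + (4 * (A'' t + z * B'' t) * (y \<bullet> h) + 2 * B' t * (h \<bullet> e)) *\<^sub>R y
     + (2 * B' t * (y \<bullet> h)) *\<^sub>R e)"

lemma has_derivative_fn: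
  "(fn has_derivative (\<lambda>h. ((2 * (A' (sqdist e x) + (x \<bullet> e) * B' (sqdist e x))) *\<^sub>R proj e x
      + B (sqdist e x) *\<^sub>R e) \<bullet> h)) (at x)"
  unfolding fn_def[abs_def]
  by (auto intro!: derivative_eq_intros has_derivative_compose_sqdist A B ext
      simp: inner_add_left inner_commute algebra_simps)

lemma grad_fn:
  "grad fn x = (2 * (A' (sqdist e x) + (x \<bullet> e) * B' (sqdist e x))) *\<^sub>R proj e x
      + B (sqdist e x) *\<^sub>R e"
  by (rule grad_eqI) (rule has_derivative_fn)

lemma has_derivative_grad_fn: "(grad fn has_derivative hess x) (at x)"
  unfolding grad_fn[abs_def]
  by (auto intro!: derivative_eq_intros has_derivative_compose_sqdist has_derivative_proj A B ext
      simp: hess_def Let_def inner_commute algebra_simps)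

lemma C2_on_fn: "C2_on S fn"
proof -
  have cont: "continuous_on S (\<lambda>x. f (sqdist e x))" if "continuous_on UNIV f"
    for f :: "real \<Rightarrow> real"
    unfolding sqdist_def[abs_def] by (intro continuous_on_compose2[OF that] continuous_intros) auto
  have AB: "continuous_on UNIV A'" "continuous_on UNIV B'"
    using A(2) B(2) by (auto intro: DERIV_continuous_on)
  have "continuous_on S (\<lambda>x. hess x h)" for h
    unfolding hess_def Let_def proj_def
    by (intro continuous_intros cont AB A(3) B(3))
  then have "continuous_on S (hessian fn)"
    unfolding hessian_eqI[OF has_derivative_grad_fn, abs_def]
    by (intro continuous_on_vec_lambda continuous_on_component)
  then show ?thesis
    using has_derivative_fn has_derivative_grad_fn
    by (auto simp: C2_on_def differentiable_def)
qed

lemma hessian_fn: "hessian fn x *v h = hess x h"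
  by (rule hessian_mult) (rule has_derivative_grad_fn)

text \<open>Exchanging \<open>v\<close> and \<open>w\<close> swaps the two mixed terms carrying
  \<open>B'\<close>; the other terms are symmetric on their own.\<close>

lemma hess_self_adjoint: "hess x v \<bullet> w = v \<bullet> hess x w"
proof -
  have "proj e v \<bullet> w = v \<bullet> proj e w" by (rule inner_proj_commute)
  then show ?thesis
    by (simp add: hess_def Let_def inner_add_left inner_add_right inner_commute algebra_simps)
qed

text \<open>Triangle inequality and Cauchy-Schwarz, with \<open>sqrt t\<close> as the norm of
  \<open>proj e x\<close>; each of the two mixed terms contributes
  \<open>2 * \<bar>B' t\<bar> * sqrt t\<close>.\<close>

lemma norm_hess_le:
  fixes x :: "real ^ 'n"
  defines "t \<equiv> sqdist e x" and "z \<equiv> x \<bullet> e"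
  shows "norm (hess x h) \<le>
    (2 * \<bar>A' t + z * B' t\<bar> + 4 * \<bar>A'' t + z * B'' t\<bar> * t + 4 * \<bar>B' t\<bar> * sqrt t) * norm h"
proof -
  let ?y = "proj e x"
  have y: "norm ?y = sqrt t"
    by (simp add: t_def sqdist_eq[OF e] norm_eq_sqrt_inner)
  have t: "0 \<le> t" by (simp add: t_def sqdist_nonneg e)
  have yh: "\<bar>?y \<bullet> h\<bar> \<le> sqrt t * norm h"
    using Cauchy_Schwarz_ineq2[of ?y h] y by simp
  have he: "\<bar>h \<bullet> e\<bar> \<le> norm h"
    using Cauchy_Schwarz_ineq2[of h e] e by simp
  have tri: "norm (a + (p + q) + r) \<le> norm a + norm p + norm q + norm r" for a p q r :: "real ^ 'n"
    using norm_triangle_ineq[of "a + (p + q)" r] norm_triangle_ineq[of a "p + q"]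
      norm_triangle_ineq[of p q] by linarith
  have "norm (hess x h) \<le> norm ((2 * (A' t + z * B' t)) *\<^sub>R proj e h)
      + norm ((4 * (A'' t + z * B'' t) * (?y \<bullet> h)) *\<^sub>R ?y)
      + norm ((2 * B' t * (h \<bullet> e)) *\<^sub>R ?y) + norm ((2 * B' t * (?y \<bullet> h)) *\<^sub>R e)"
    unfolding hess_def Let_def t_def z_def scaleR_add_left[of _ _ ?y] by (rule tri)
  also have "\<dots> = 2 * \<bar>A' t + z * B' t\<bar> * norm (proj e h)
      + 4 * \<bar>A'' t + z * B'' t\<bar> * \<bar>?y \<bullet> h\<bar> * sqrt t
      + 2 * \<bar>B' t\<bar> * \<bar>h \<bullet> e\<bar> * sqrt t + 2 * \<bar>B' t\<bar> * \<bar>?y \<bullet> h\<bar>"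
    unfolding norm_scaleR y e abs_mult using t by simp
  also have "\<dots> \<le> 2 * \<bar>A' t + z * B' t\<bar> * norm h
      + 4 * \<bar>A'' t + z * B'' t\<bar> * (sqrt t * norm h) * sqrt t
      + 2 * \<bar>B' t\<bar> * norm h * sqrt t + 2 * \<bar>B' t\<bar> * (sqrt t * norm h)"
    using t yh he norm_proj_le[OF e, of h]
    by (intro add_mono mult_right_mono mult_left_mono) auto
  also have "\<dots> = (2 * \<bar>A' t + z * B' t\<bar> + 4 * \<bar>A'' t + z * B'' t\<bar> * (sqrt t * sqrt t)
      + 4 * \<bar>B' t\<bar> * sqrt t) * norm h"
    by (simp add: algebra_simps)
  finally show ?thesis using t by simp
qed

text \<open>The radial and axial parts of the gradient are orthogonal, so each is dominated by the
  whole. The first bound serves away from the axis, the second near it.\<close>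

lemma grad_lower_bounds:
  fixes x :: "real ^ 'n"
  defines "t \<equiv> sqdist e x" and "z \<equiv> x \<bullet> e"
  shows "2 * \<bar>A' t + z * B' t\<bar> * sqrt t \<le> norm (grad fn x)" "\<bar>B t\<bar> \<le> norm (grad fn x)"
proof -
  let ?y = "proj e x" and ?c = "2 * (A' t + z * B' t)"
  have yy: "?y \<bullet> ?y = t" by (simp add: t_def sqdist_eq[OF e])
  have t: "0 \<le> t" by (simp add: t_def sqdist_nonneg e)
  have "orthogonal (?c *\<^sub>R ?y) (B t *\<^sub>R e)"
    by (simp add: orthogonal_def proj_inner_axis e)
  then have "(norm (grad fn x))\<^sup>2 = (norm (?c *\<^sub>R ?y))\<^sup>2 + (norm (B t *\<^sub>R e))\<^sup>2"
    unfolding grad_fn t_def z_def by (rule norm_add_Pythagorean)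
  then have "(norm (grad fn x))\<^sup>2 = ?c\<^sup>2 * t + (B t)\<^sup>2"
    unfolding norm_scaleR power_mult_distrib e dot_square_norm[symmetric] yy
    by (simp del: distrib_left_numeral)
  moreover have "(2 * \<bar>A' t + z * B' t\<bar> * sqrt t)\<^sup>2 = ?c\<^sup>2 * t"
    using t by (simp add: power_mult_distrib del: distrib_left_numeral)
  ultimately have "(2 * \<bar>A' t + z * B' t\<bar> * sqrt t)\<^sup>2 \<le> (norm (grad fn x))\<^sup>2"
    "\<bar>B t\<bar>\<^sup>2 \<le> (norm (grad fn x))\<^sup>2"
    using t by simp_all
  then show "2 * \<bar>A' t + z * B' t\<bar> * sqrt t \<le> norm (grad fn x)" "\<bar>B t\<bar> \<le> norm (grad fn x)"
    by (auto intro: power2_le_imp_le)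
qed

end

subsection \<open>The tube functions\<close>

text \<open>To the left of 1 both corrections in the Taylor polynomial are nonnegative.\<close>

lemma cap_ge_1:
  assumes "s \<le> 1" shows "1 \<le> cap p s"
proof -
  have "real p * (s - 1) \<le> 0" "0 \<le> real p * (real p + 1) / 2 * (s - 1)\<^sup>2"
    using assms by (auto intro: mult_nonneg_nonpos)
  moreover have "cap p s = 1 - real p * (s - 1) + real p * (real p + 1) / 2 * (s - 1)\<^sup>2"
    using assms by (simp only: cap_def if_True)
  ultimately show ?thesis by linarith
qed

lemma bump_bounds: "0 \<le> s \<Longrightarrow> s \<le> 1 \<Longrightarrow> 0 \<le> bump s \<and> bump s \<le> 1"
  by (simp add: bump_def power_le_one)

locale tube =
  fixes e :: "real ^ 'n" and p :: nat and d :: real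
  assumes e: "norm e = 1" and p: "1 \<le> p" and d: "0 < d" "d \<le> 1"
begin

text \<open>The factor \<open>d\<^sup>1\<^sup>-\<^sup>p\<close> makes the function equal to \<open>d * t\<^sup>-\<^sup>p\<close> outside the tube \<open>t \<le> d\<close>.\<close>

definition K :: real where "K = (1 / d) ^ (p - 1)"

definition A :: "real \<Rightarrow> real" where "A t = K * cap p (t / d)"
definition A' :: "real \<Rightarrow> real" where "A' t = K / d * cap' p (t / d)"
definition A'' :: "real \<Rightarrow> real" where "A'' t = K / d\<^sup>2 * cap'' p (t / d)"
text \<open>For \<bar>z\<bar> \<le> 2 the factor 1/12 leaves the tilt too weak to destroy positivity
  or to take more than 1/2 off the normalised radial slope.\<close>

definition B :: "real \<Rightarrow> real" where "B t = K / 12 * bump (t / d)"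
definition B' :: "real \<Rightarrow> real" where "B' t = K / 12 / d * bump' (t / d)"
definition B'' :: "real \<Rightarrow> real" where "B'' t = K / 12 / d\<^sup>2 * bump'' (t / d)"

sublocale axial e A A' A'' B B' B''
proof
  show "norm e = 1" by (rule e)
  have D: "((\<lambda>t. c * f (t / d)) has_real_derivative c / d * f' (t / d)) (at t)"
    if "\<And>t. (f has_real_derivative f' t) (at t)" for f f' c t
    using d by (auto intro!: derivative_eq_intros DERIV_chain2[OF that])
  show "(A has_real_derivative A' t) (at t)" "(B has_real_derivative B' t) (at t)"
    "(A' has_real_derivative A'' t) (at t)" "(B' has_real_derivative B'' t) (at t)" for t
    using D[OF DERIV_cap, of K p t] D[OF DERIV_cap', of "K / d" p t]
      D[OF DERIV_bump, of "K / 12" t] D[OF DERIV_bump', of "K / 12 / d" t]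
    unfolding A_def[abs_def] A'_def[abs_def] A''_def[abs_def]
      B_def[abs_def] B'_def[abs_def] B''_def[abs_def]
    by (simp_all add: power2_eq_square mult.assoc)
  have C: "continuous_on UNIV (\<lambda>t. c * f (t / d))" if "continuous_on UNIV f" for c and f :: "real \<Rightarrow> real"
    using d by (intro continuous_intros continuous_on_compose2[OF that]) auto
  show "continuous_on UNIV A''" "continuous_on UNIV B''"
    unfolding A''_def[abs_def] B''_def[abs_def]
    by (rule C continuous_cap'' continuous_bump'')+
qed

section \<open>Values of the tube functions: outside the tube, at the origin, and their sign\<close>

lemma K_ge_1: "1 \<le> K"
  using d by (simp add: K_def one_le_power)

lemma fn_outside:
  assumes "d < sqdist e x"
  shows "fn x = d / sqdist e x ^ p"
proof -
  \<comment> \<open>This relies on \<open>1 \<le> p\<close>, since \<open>p - 1\<close> is truncated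
    subtraction.\<close>
  have "K * d ^ p = d"
    using p d power_Suc2[of d "p - 1"] by (simp add: K_def power_one_over)
  then show ?thesis
    using assms d by (simp add: fn_def A_def B_def cap_def bump_def power_divide)
qed

text \<open>The tilt vanishes at the origin, leaving \<open>K * cap p 0\<close>. This keeps the
  supremum over the unit ball from falling below 1.\<close>

lemma fn_zero: "1 \<le> fn 0"
  using K_ge_1 cap_ge_1[of 0 p] mult_mono[of 1 K 1 "cap p 0"] by (simp add: fn_def A_def sqdist_def)

text \<open>Inside the tube, in units of \<open>K\<close>, the cap is at least 1 and the tilt at
  most 2/12.\<close>

lemma fn_pos:
  assumes "\<bar>x \<bullet> e\<bar> \<le> 2"
  shows "0 < fn x"
proof (cases "d < sqdist e x")
  case True
  then show ?thesis using d unfolding fn_outside[OF True] by simp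
next
  case False
  define s where "s = sqdist e x / d"
  have s: "0 \<le> s" "s \<le> 1"
    using False d by (auto simp: s_def sqdist_nonneg e)
  have "\<bar>(x \<bullet> e) * bump s\<bar> \<le> 2 * 1"
    unfolding abs_mult using assms bump_bounds[OF s] by (intro mult_mono) auto
  then have "0 < cap p s + (x \<bullet> e) * bump s / 12"
    using cap_ge_1[OF s(2), of p] by linarith
  then have "0 < K * (cap p s + (x \<bullet> e) * bump s / 12)"
    using K_ge_1 by simp
  then show ?thesis by (simp add: fn_def A_def B_def s_def algebra_simps)
qed

text \<open>The n - 2 tangential eigenvalues are \<open>- r\<close> and the radial one is
  \<open>(2 * p + 1) * r\<close>; with weights 2p + 1 on the negative and n - 2 on the positive side
  they cancel exactly.\<close>

lemma pucci_outside:
  assumes "d < sqdist e x" and "2 \<le> CARD('n)"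
  shows "pucci_minus (real CARD('n) - 2) (2 * real p + 1) (hessian fn x) = 0"
proof -
  define t where "t = sqdist e x"
  define y where "y = proj e x"
  have t: "0 < t" "d < t" and td: "\<not> t / d \<le> 1" "0 < t / d"
    using assms d by (auto simp: t_def)
  have yy: "y \<bullet> y = t" by (simp add: y_def t_def sqdist_eq[OF e])
  \<comment> \<open>Minus the tangential eigenvalue \<open>2 * A' t\<close>. For a power of
    \<open>t\<close>, \<open>4 * A'' t * t\<close> is \<open>2 * p + 2\<close> times this.\<close>
  define r where "r = 2 * real p * (K / d) / (t / d) ^ (p + 1)"
  have r: "r > 0" using K_ge_1 d p td by (simp add: r_def)
  have b: "2 * A' t = - r"
    using td by (simp add: A'_def cap'_def r_def)
  have c: "4 * A'' t * t = (2 * real p + 2) * r"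
    using td t d by (simp add: A''_def cap''_def r_def power2_eq_square field_simps)
  define c where "c = 4 * A'' t"
  have ct: "c * (y \<bullet> y) = (2 * real p + 2) * r"
    using c by (simp add: c_def yy)
  have M: "hessian fn x *v h = (- r) *\<^sub>R (h - (h \<bullet> e) *\<^sub>R e) + (c * (y \<bullet> h)) *\<^sub>R y" for h
  proof -
    have "B' t = 0" "B'' t = 0"
      using td by (simp_all add: B'_def B''_def bump'_def bump''_def)
    then show ?thesis
      unfolding hessian_fn hess_def Let_def t_def[symmetric] y_def[symmetric]
      by (simp add: b[symmetric] c_def proj_def)
  qed
  have "y \<noteq> 0" using yy t by auto
  moreover have "y \<bullet> e = 0" by (simp add: y_def proj_inner_axis e)
  moreover have "- r + c * (y \<bullet> y) > 0"
    unfolding ct using r by (simp add: algebra_simps add_pos_nonneg)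
  ultimately have "pucci_minus (real CARD('n) - 2) (2 * real p + 1) (hessian fn x)
      = (real CARD('n) - 2) * (- r + c * (y \<bullet> y)) + (2 * real p + 1) * (real (CARD('n) - 2) * (- r))"
    using r by (intro pucci_minus_two_eigenspaces[OF M e]) auto
  also have "\<dots> = 0"
    unfolding ct using assms(2) by (simp add: of_nat_diff algebra_simps)
  finally show ?thesis .
qed

text \<open>All Hessian coefficients scale at worst like \<open>K / d\<close>, whereas the gradient
  is at least of order \<open>K\<close>: by the tilt near the axis, by the radial slope
  elsewhere.\<close>

lemma inside_bounds:
  assumes "sqdist e x \<le> d" and z: "\<bar>x \<bullet> e\<bar> \<le> 2"
  shows "norm (hess x h) \<le> 7 * (real p + 1)\<^sup>2 * (K / d) * norm h"
    and "K / 32 \<le> norm (grad fn x)"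
proof -
  define t z s where "t = sqdist e x" and "z = x \<bullet> e" and "s = t / d"
  have t: "0 \<le> t" "t \<le> d"
    using assms by (auto simp: t_def sqdist_nonneg e)
  have s: "0 \<le> s" "s \<le> 1" using t d by (auto simp: s_def)
  have z: "\<bar>z\<bar> \<le> 2" using z by (simp add: z_def)
  have K: "0 < K" using K_ge_1 by simp
  have st: "sqrt t \<le> 1" using t d by simp
  have bump': "\<bar>bump' s\<bar> \<le> 3" and bump'': "\<bar>bump'' s\<bar> \<le> 6"
    using s by (auto simp: bump'_def bump''_def abs_mult power_le_one)
  have zb: "\<bar>z * bump' s\<bar> \<le> 2 * 3" "\<bar>z * bump'' s\<bar> \<le> 2 * 6"
    unfolding abs_mult using z bump' bump'' by (intro mult_mono; simp)+
  have cap': "cap' p s \<le> - real p" "- (real p + real p * (real p + 1)) \<le> cap' p s"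
  proof -
    have "real p * (real p + 1) * (1 - s) \<le> real p * (real p + 1) * 1"
      using s by (intro mult_left_mono) auto
    moreover have "0 \<le> real p * (real p + 1) * (1 - s)"
      using s by simp
    ultimately show "cap' p s \<le> - real p" "- (real p + real p * (real p + 1)) \<le> cap' p s"
      using s by (auto simp: cap'_def algebra_simps)
  qed
  have cap'': "cap'' p s = real p * (real p + 1)"
    using s by (simp add: cap''_def)
  \<comment> \<open>The coefficients in units of \<open>K / d\<close> and
    \<open>K / d\<^sup>2\<close>. The tilt changes them by at most 1/2 and 1, and
    \<open>cap' p s \<le> - p \<le> - 1\<close> leaves \<open>?g\<close> of modulus at least
    1/2.\<close>
  let ?g = "cap' p s + z * bump' s / 12" and ?h = "cap'' p s + z * bump'' s / 12"
  have g: "\<bar>?g\<bar> \<le> (real p + 1)\<^sup>2" and g': "1 / 2 \<le> \<bar>?g\<bar>"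
    using cap' zb p by (auto simp: power2_eq_square algebra_simps abs_le_iff)
  have h: "\<bar>?h\<bar> \<le> (real p + 1)\<^sup>2"
  proof -
    have "\<bar>?h\<bar> \<le> real p * (real p + 1) + 1"
      using zb(2) mult_nonneg_nonneg[of "real p" "real p + 1"] unfolding cap'' by linarith
    also have "\<dots> \<le> (real p + 1)\<^sup>2"
      by (simp add: power2_eq_square algebra_simps)
    finally show ?thesis .
  qed
  have gA: "A' t + z * B' t = K / d * ?g"
    "A'' t + z * B'' t = K / d\<^sup>2 * ?h"
    by (simp_all add: A'_def A''_def B'_def B''_def s_def algebra_simps)
  have "norm (hess x h) \<le> (2 * \<bar>K / d * ?g\<bar> + 4 * \<bar>K / d\<^sup>2 * ?h\<bar> * t
      + 4 * \<bar>K / 12 / d * bump' s\<bar> * sqrt t) * norm h"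
    using norm_hess_le[of x h] unfolding t_def[symmetric] z_def[symmetric] gA
    unfolding B'_def s_def[symmetric] .
  also have "\<dots> \<le> (7 * (real p + 1)\<^sup>2 * (K / d)) * norm h"
  \<comment> \<open>The constant 7 is 2 + 4 + 1. In the second term \<open>t \<le> d\<close> cancels
    one factor \<open>1 / d\<close>; in the third \<open>sqrt t \<le> 1\<close> suffices.\<close>
  proof (rule mult_right_mono)
    have 1: "\<bar>K / d * ?g\<bar> \<le> K / d * (real p + 1)\<^sup>2"
      unfolding abs_mult using K d g by (intro mult_mono) auto
    have "\<bar>K / d\<^sup>2 * ?h\<bar> * t \<le> (K / d\<^sup>2 * (real p + 1)\<^sup>2) * d"
      unfolding abs_mult using K d h t by (intro mult_mono) auto
    also have "\<dots> = K / d * (real p + 1)\<^sup>2"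
      using d by (simp add: power2_eq_square)
    finally have 2: "\<bar>K / d\<^sup>2 * ?h\<bar> * t \<le> K / d * (real p + 1)\<^sup>2" .
    have "\<bar>K / 12 / d * bump' s\<bar> * sqrt t \<le> (K / 12 / d * 3) * 1"
      unfolding abs_mult using K d bump' t st by (intro mult_mono) auto
    also have "\<dots> = 1 / 4 * (K / d * 1)" by simp
    also have "\<dots> \<le> 1 / 4 * (K / d * (real p + 1)\<^sup>2)"
      using K d by (intro mult_left_mono) auto
    finally have 3: "\<bar>K / 12 / d * bump' s\<bar> * sqrt t \<le> 1 / 4 * (K / d * (real p + 1)\<^sup>2)" .
    have "7 * (real p + 1)\<^sup>2 * (K / d) = 7 * (K / d * (real p + 1)\<^sup>2)" by simp
    then show "2 * \<bar>K / d * ?g\<bar> + 4 * \<bar>K / d\<^sup>2 * ?h\<bar> * t + 4 * \<bar>K / 12 / d * bump' s\<bar> * sqrt t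
        \<le> 7 * (real p + 1)\<^sup>2 * (K / d)"
      using 1 2 3 unfolding mult.assoc[of 4] by linarith
  qed simp
  finally show "norm (hess x h) \<le> 7 * (real p + 1)\<^sup>2 * (K / d) * norm h" .
  \<comment> \<open>The radial part degenerates on the axis, so for \<open>s \<le> 1 / 4\<close> the
    tilt is used: (1/12) (3/4)^3 = 9/256 exceeds 1/32.\<close>
  show "K / 32 \<le> norm (grad fn x)"
  proof (cases "s \<le> 1 / 4")
    case True
    then have "(3 / 4) ^ 3 \<le> (1 - s) ^ 3"
      by (intro power_mono) auto
    then have "27 / 64 \<le> bump s"
      using s by (simp add: bump_def power3_eq_cube)
    then have "K / 12 * (27 / 64) \<le> K / 12 * bump s"
      using K by (intro mult_left_mono) auto
    then have "K / 32 \<le> \<bar>K / 12 * bump s\<bar>" using K by linarith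
    then show ?thesis
      using grad_lower_bounds(2)[of x] unfolding B_def t_def[symmetric] s_def[symmetric] by linarith
  next
    case False
    \<comment> \<open>Here \<open>t > d / 4\<close>, and \<open>d \<le> 1\<close> turns this into
      \<open>sqrt t \<ge> d / 2\<close>, which makes the radial part at least
      \<open>K / 2\<close>.\<close>
    have "d\<^sup>2 / 4 \<le> d / 4" using d by (simp add: power2_eq_square mult_left_le)
    also have "\<dots> \<le> t" using False d by (simp add: s_def field_simps)
    finally have "(d / 2)\<^sup>2 \<le> t" by (simp add: power_divide)
    then have "d / 2 \<le> sqrt t" by (rule real_le_rsqrt)
    then have "2 * (K / d * (1 / 2)) * (d / 2) \<le> 2 * \<bar>K / d * ?g\<bar> * sqrt t"
      unfolding abs_mult using K d g' by (intro mult_mono) auto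
    also have "\<dots> \<le> norm (grad fn x)"
      using grad_lower_bounds(1)[of x] unfolding t_def[symmetric] z_def[symmetric] gA .
    finally show ?thesis using K d by simp
  qed
qed

text \<open>Outside the tube the left side is zero. Inside it is at most a constant times
  \<open>K / d\<close>, to be beaten by \<open>(K / 32) powr (1 + eps)\<close>; the surplus
  \<open>K powr eps\<close> supplies two factors \<open>1 / d\<close>, one for the constant and one
  for the quotient.\<close>

lemma pucci_le_gradient:
  assumes n: "3 \<le> CARD('n)" "CARD('n) \<le> p" and eps: "eps > 0" "2 \<le> real (p - 1) * eps"
    and small: "(2 * real p + 1) * (real CARD('n))\<^sup>2 * (7 * (real p + 1)\<^sup>2) * 32 powr (1 + eps) \<le> 1 / d"
    and x: "\<bar>x \<bullet> e\<bar> \<le> 2"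
  shows "\<bar>pucci_minus (real CARD('n) - 2) (2 * real p + 1) (hessian fn x)\<bar>
    \<le> norm (grad fn x) powr (1 + eps)"
proof (cases "d < sqdist e x")
  case True
  then show ?thesis using pucci_outside n by simp
next
  case False
  let ?C = "(2 * real p + 1) * (real CARD('n))\<^sup>2 * (7 * (real p + 1)\<^sup>2)"
  have in_tube: "sqdist e x \<le> d" using False by simp
  have K: "1 \<le> K" by (rule K_ge_1)
  have "\<bar>pucci_minus (real CARD('n) - 2) (2 * real p + 1) (hessian fn x)\<bar>
      \<le> (2 * real p + 1) * (real CARD('n))\<^sup>2 * (7 * (real p + 1)\<^sup>2 * (K / d))"
    using n inside_bounds(1)[OF in_tube x]
    by (intro abs_pucci_minus_le) (auto simp: hessian_fn hess_self_adjoint)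
  also have "\<dots> = ?C * (K / d)" by simp
  \<comment> \<open>\<open>small\<close> trades the constant, together with the power of 32, for one
    factor \<open>1 / d\<close>.\<close>
  also have "\<dots> \<le> (1 / d / 32 powr (1 + eps)) * (K / d)"
    using small K d by (intro mult_right_mono) (auto simp: field_simps)
  also have "\<dots> = K * (1 / d)\<^sup>2 / 32 powr (1 + eps)"
    by (simp add: power2_eq_square)
  also have "\<dots> \<le> K * K powr eps / 32 powr (1 + eps)"
  proof -
    have "(1 / d)\<^sup>2 = (1 / d) powr 2"
      using d by simp
    also have "\<dots> \<le> (1 / d) powr (real (p - 1) * eps)"
      using d by (intro powr_mono eps(2)) simp
    also have "\<dots> = K powr eps"
      using d powr_realpow[of "1 / d" "p - 1"] unfolding K_def powr_powr[symmetric] by simp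
    finally show ?thesis using K by (intro divide_right_mono mult_left_mono) auto
  qed
  also have "\<dots> = (K / 32) powr (1 + eps)"
    using K by (simp add: powr_divide powr_add)
  also have "\<dots> \<le> norm (grad fn x) powr (1 + eps)"
    using inside_bounds(2)[OF in_tube x] K eps by (intro powr_mono2) auto
  finally show ?thesis .
qed

end

subsection \<open>Divergence of the integral and choice of the sequence\<close>

text \<open>On (0, 1] the power is at most \<open>s\<close>, so the integrand is at least
  \<open>1 / (2 * s)\<close>, whose integral from \<open>m k\<close> to 1 is
  \<open>- ln (m k) / 2\<close>. The part beyond 1 only adds.\<close>

lemma filterlim_integral_at_top:
  fixes m M :: "nat \<Rightarrow> real"
  assumes eps: "eps > 0" and m: "\<And>k. m k > 0" "m \<longlonglongrightarrow> 0" and M: "\<And>k. M k \<ge> 1"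
  shows "filterlim (\<lambda>k. integral {m k..M k} (\<lambda>s. 1 / (s powr (1 + eps) + s))) at_top sequentially"
proof (rule filterlim_at_top_mono)
  let ?f = "\<lambda>s::real. 1 / (s powr (1 + eps) + s)"
  have "filterlim m (at_right 0) sequentially"
    using m(2) by (simp add: filterlim_at m(1) less_imp_neq[OF m(1), symmetric])
  then have "filterlim (\<lambda>k. ln (m k)) at_bot sequentially"
    by (rule filterlim_compose[OF ln_at_0])
  then have "filterlim (\<lambda>k. - ln (m k)) at_top sequentially"
    by (simp add: filterlim_uminus_at_top)
  then show "filterlim (\<lambda>k. (1 / 2) * (- ln (m k))) at_top sequentially"
    by (intro filterlim_tendsto_pos_mult_at_top[OF tendsto_const]) simp_all
  have "\<forall>\<^sub>F k in sequentially. m k < 1"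
    using m(2) by (rule order_tendstoD) simp
  then show "\<forall>\<^sub>F k in sequentially. (1 / 2) * (- ln (m k)) \<le> integral {m k..M k} ?f"
  proof eventually_elim
    case (elim k)
    have pos: "0 < s powr (1 + eps) + s" if "0 < s" for s
      using that by (intro add_pos_pos) auto
    have int: "?f integrable_on {a..b}" if "0 < a" for a b
    proof (intro integrable_continuous_real continuous_intros ballI)
      fix s assume "s \<in> {a..b}"
      then have "0 < s" using that by auto
      then show "s powr (1 + eps) + s \<noteq> 0" "s \<noteq> 0" using pos[of s] by auto
    qed
    have "((\<lambda>s. 1 / (2 * s)) has_integral (ln 1 / 2 - ln (m k) / 2)) {m k..1}"
    proof (rule fundamental_theorem_of_calculus)
      fix s assume "s \<in> {m k..1}"
      then have "0 < s" using m(1)[of k] by auto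
      then have "((\<lambda>s. ln s / 2) has_real_derivative 1 / (2 * s)) (at s within {m k..1})"
        by (auto intro!: derivative_eq_intros)
      then show "((\<lambda>s. ln s / 2) has_vector_derivative 1 / (2 * s)) (at s within {m k..1})"
        by (simp add: has_real_derivative_iff_has_vector_derivative)
    qed (use elim in simp)
    then have "(1 / 2) * (- ln (m k)) = integral {m k..1} (\<lambda>s. 1 / (2 * s))"
      and i: "(\<lambda>s. 1 / (2 * s)) integrable_on {m k..1}"
      by (simp_all add: has_integral_iff)
    note this(1)
    also have "integral {m k..1} (\<lambda>s. 1 / (2 * s)) \<le> integral {m k..1} ?f"
    proof (rule integral_le[OF i int])
      fix s assume s: "s \<in> {m k..1}"
      then have "s > 0" using m(1)[of k] by auto
      then have "s powr (1 + eps) \<le> s powr 1"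
        using s eps by (intro powr_mono') auto
      then show "1 / (2 * s) \<le> ?f s"
        using \<open>s > 0\<close> pos[of s] by (intro divide_left_mono) auto
    qed (rule m)
    also have "\<dots> \<le> integral {m k..M k} ?f"
      using M[of k] m(1)[of k]
      by (intro integral_subset_le int) auto
    finally show ?case .
  qed
qed

section \<open>Choice of parameters and assembly of the sequence\<close>

theorem theorem1p1:
  fixes eps0 :: real
  assumes "CARD('n::finite) \<ge> 3" and "eps0 > 0"
  shows "\<exists>(l::real) (L::real) (u :: nat \<Rightarrow> real ^ 'n \<Rightarrow> real).
     0 < l \<and> l \<le> L \<and>
     (\<forall>k. C2_on (ball 0 2) (u k) \<and>
          (\<forall>x\<in>ball 0 2. u k x > 0) \<and>
          (\<forall>x\<in>ball 0 2. \<bar>pucci_minus l L (hessian (u k) x)\<bar> \<le> norm (grad (u k) x) powr (1 + eps0))) \<and>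
     (let m = (\<lambda>k. INF x\<in>ball 0 1. u k x);
          M = (\<lambda>k. SUP x\<in>ball 0 1. u k x)
      in m \<longlonglongrightarrow> 0 \<and>
         (\<forall>k. M k \<ge> 1) \<and>
         filterlim (\<lambda>k. integral {m k..M k} (\<lambda>s. 1 / (s powr (1 + eps0) + s))) at_top sequentially)"
proof -
  \<comment> \<open>The cardinality gives \<lambda> \<le> \<Lambda>, the ceiling makes
    \<open>(p - 1) * eps0\<close> at least 2, and \<open>Suc\<close> makes up for the
    \<open>- 1\<close>.\<close>
  define p where "p = Suc (CARD('n) + nat \<lceil>2 / eps0\<rceil>)"
  have p: "1 \<le> p" "CARD('n) \<le> p" by (simp_all add: p_def)
  have "2 / eps0 \<le> real (p - 1)"
    unfolding p_def by linarith
  then have p_eps: "2 \<le> real (p - 1) * eps0"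
    using assms(2) by (simp only: pos_divide_le_eq)
  obtain i j :: 'n where ij: "i \<noteq> j"
    using assms(1) card_le_Suc0_iff_eq[of "UNIV :: 'n set"] by auto
  \<comment> \<open>\<open>e\<close> spans the axis of the tubes; \<open>w\<close> is a point of the
    unit ball at distance 1/2 from it, at which \<open>u k\<close> will be small.\<close>
  define e w :: "real ^ 'n" where "e = axis i 1" and "w = (1 / 2) *\<^sub>R axis j 1"
  have e: "norm e = 1" by (simp add: e_def)
  have w: "norm w = 1 / 2" "w \<bullet> e = 0"
    using ij by (simp_all add: w_def e_def inner_axis_axis)
  define C where "C = (2 * real p + 1) * (real CARD('n))\<^sup>2 * (7 * (real p + 1)\<^sup>2) * 32 powr (1 + eps0)"
  have C: "0 \<le> C" by (simp add: C_def)
  \<comment> \<open>\<open>C\<close> secures the smallness condition, \<open>k\<close> drives the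
    width to 0, and 8 keeps it below 1/4, the squared distance of \<open>w\<close> from the
    axis.\<close>
  define d where "d k = 1 / (C + real k + 8)" for k
  have d: "0 < d k" "d k \<le> 1 / 8" "C \<le> 1 / d k" for k
    using C by (simp_all add: d_def field_simps)
  have "d k \<le> 1" for k
    using d(2)[of k] by linarith
  then have tube: "tube e p (d k)" for k
    by unfold_locales (use e p d in auto)
  define u where "u k = axial.fn e (tube.A p (d k)) (tube.B p (d k))" for k
  have u_pos: "0 < u k x" if "\<bar>x \<bullet> e\<bar> \<le> 2" for k x
    unfolding u_def by (rule tube.fn_pos[OF tube that])
  have C2: "C2_on S (u k)" for S k
  proof -
    interpret tube e p "d k" by (rule tube)
    show ?thesis unfolding u_def by (rule C2_on_fn)
  qed
  have pucci: "\<bar>pucci_minus (real CARD('n) - 2) (2 * real p + 1) (hessian (u k) x)\<bar>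
      \<le> norm (grad (u k) x) powr (1 + eps0)" if "\<bar>x \<bullet> e\<bar> \<le> 2" for k x
    unfolding u_def
    by (rule tube.pucci_le_gradient[OF tube assms(1) p(2) assms(2) p_eps d(3)[unfolded C_def] that])
  have slab: "\<bar>x \<bullet> e\<bar> \<le> 2" if "norm x \<le> 2" for x
    using Cauchy_Schwarz_ineq2[of x e] e that by simp
  define m M where "m k = (INF x\<in>ball 0 1. u k x)" and "M k = (SUP x\<in>ball 0 1. u k x)" for k
  have cont: "continuous_on (cball 0 1) (u k)" for k
    using C2[of UNIV k] by (auto simp: C2_on_def intro!: continuous_at_imp_continuous_on
      differentiable_imp_continuous_within)
  \<comment> \<open>The functions live on the whole space, so extrema over the closed unit ball
    exist; the positive minimum makes \<open>m k\<close> strictly positive, and both extrema provide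
    the boundedness that \<open>INF\<close> and \<open>SUP\<close> require.\<close>
  have mM: "0 < m k" "m k \<le> d k * 4 ^ p" "1 \<le> M k" for k
  proof -
    obtain a where a: "norm a \<le> 1" "\<And>x. norm x \<le> 1 \<Longrightarrow> u k a \<le> u k x"
      using continuous_attains_inf[OF compact_cball _ cont[of k]] by auto
    obtain b where b: "\<forall>x\<in>cball 0 1. u k x \<le> u k b"
      using continuous_attains_sup[OF compact_cball _ cont[of k]] by auto
    have "0 < u k a" using a(1) by (intro u_pos slab) simp
    also have "u k a \<le> m k" unfolding m_def using a by (intro cINF_greatest) auto
    finally show "0 < m k" .
    have "bdd_below (u k ` ball 0 1)" using a by (intro bdd_belowI2[of _ "u k a"]) auto
    then have "m k \<le> u k w" unfolding m_def using w by (intro cINF_lower) auto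
    also have "u k w = d k * 4 ^ p"
    proof -
      have t: "sqdist e w = 1 / 4" unfolding sqdist_def dot_square_norm w by (simp add: power2_eq_square)
      then have "u k w = d k / (1 / 4) ^ p"
        using tube.fn_outside[OF tube, of k w] d(2)[of k] unfolding u_def t by simp
      then show ?thesis by (simp add: power_one_over)
    qed
    finally show "m k \<le> d k * 4 ^ p" .
    have "bdd_above (u k ` ball 0 1)" using b by (intro bdd_aboveI2[of _ _ "u k b"]) auto
    then have "u k 0 \<le> M k" unfolding M_def by (intro cSUP_upper) auto
    moreover have "1 \<le> u k 0" unfolding u_def by (rule tube.fn_zero[OF tube])
    ultimately show "1 \<le> M k" by simp
  qed
  have "filterlim (\<lambda>k. (C + 8) + real k) at_top sequentially"
    by (rule filterlim_tendsto_add_at_top[OF tendsto_const filterlim_real_sequentially])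
  then have "d \<longlonglongrightarrow> 0"
    using tendsto_inverse_0_at_top unfolding d_def[abs_def] by (force simp: add_ac divide_inverse)
  then have "(\<lambda>k. d k * 4 ^ p) \<longlonglongrightarrow> 0" by (rule tendsto_mult_left_zero)
  then have m0: "m \<longlonglongrightarrow> 0"
    by (rule real_tendsto_sandwich[OF _ _ tendsto_const, rotated 2])
      (use mM in \<open>auto simp: less_imp_le\<close>)
  show ?thesis
  proof (intro exI conjI allI ballI)
    show "0 < real CARD('n) - 2" using assms(1) by simp
    show "real CARD('n) - 2 \<le> 2 * real p + 1" using p(2) by linarith
    show "C2_on (ball 0 2) (u k)" for k by (rule C2)
    show "0 < u k x" if "x \<in> ball 0 2" for k x
      using that by (intro u_pos slab) simp
    show "\<bar>pucci_minus (real CARD('n) - 2) (2 * real p + 1) (hessian (u k) x)\<bar>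
        \<le> norm (grad (u k) x) powr (1 + eps0)" if "x \<in> ball 0 2" for k x
      using that by (intro pucci slab) simp
    show "let m = \<lambda>k. INF x\<in>ball 0 1. u k x; M = \<lambda>k. SUP x\<in>ball 0 1. u k x
      in m \<longlonglongrightarrow> 0 \<and> (\<forall>k. 1 \<le> M k) \<and>
         filterlim (\<lambda>k. integral {m k..M k} (\<lambda>s. 1 / (s powr (1 + eps0) + s))) at_top sequentially"
      using m0 mM(3) filterlim_integral_at_top[of eps0 m M, OF assms(2) mM(1) m0 mM(3)]
      unfolding Let_def m_def[abs_def] M_def[abs_def] by blast
  qed
qed

end
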